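(* Let $n\ge 2$, $\varepsilon>0$ and $q\in\mathbb{Q}\cap[0,1]$. For $y\in\mathbb{R}^{n(n-1)/2}$ let $X(y)$ denote the symmetric $n\times n$ matrix with unit diagonal whose strictly upper triangular part is given by $y$, and let $f(y)=\Phi(X(y),\varepsilon)$, where $$\Phi(X,\varepsilon)=(1+\varepsilon^q)\,\operatorname{tr}\left(X^{T}(XX^{T}+\varepsilon I)^{-1}X\right).$$ Let $x\in\mathbb{R}^{n(n-1)/2}$ be such that $X(x)\succeq 0$. Then for every step size $\alpha$ with $0\le\alpha\le \frac{\varepsilon}{4(1+\varepsilon^q)}$ we have $X(x-\alpha\nabla f(x))\succeq 0$.
   Context: All matrices are real; $X\succeq 0$ means that $X$ is symmetric positive semidefinite, and $I$ is the $n\times n$ identity matrix. For a vector $y=(y_1,\dots,y_{n(n-1)/2})$, the matrix $X(y)$ is defined by $X(y)_{ii}=1$ for all $i$, and, for $i<j$, $X(y)_{ij}=X(y)_{ji}=y_d$ with $d=\sum_{k=1}^{i-1}(n-k)+j-i$ (that is, $y$ lists the strictly upper triangular entries row by row). The function $\Phi(\cdot,\varepsilon)$ is called the singular value relaxation of the rank. $\nabla f$ is the ordinary gradient of $f:\mathbb{R}^{n(n-1)/2}\to\mathbb{R}$ with respect to the vector variable. *)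

theory Defs
  imports "HOL-Analysis.Analysis"
begin

text \<open>
  A finite linearly ordered index type \<open>'n\<close> with \<open>CARD('n) = n\<close> plays the role of the index set
  \<open>{1..n}\<close>; the position of an index (starting from 1) is its rank in the order.
\<close>

definition pos :: "'a::{finite,linorder} \<Rightarrow> nat" where
  "pos i = card {..i}"

definition upper_index :: "nat \<Rightarrow> nat \<Rightarrow> nat \<Rightarrow> nat" where
  "upper_index n i j = (\<Sum>k = 1..i - 1. n - k) + (j - i)"

text \<open>
  The intended use is with \<open>CARD('m) = n (n - 1) / 2\<close>; the lemma \<open>ex1_pos_upper_index\<close> below
  shows that the definite descriptions then denote.
\<close>

definition unit_diag_matrix :: "real^'m::{finite,linorder} \<Rightarrow> real^'n::{finite,linorder}^'n::{finite,linorder}" where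
  "unit_diag_matrix y = (\<chi> i j.
     if i = j then 1
     else if i < j then y $ (THE d. pos d = upper_index CARD('n) (pos i) (pos j))
     else y $ (THE d. pos d = upper_index CARD('n) (pos j) (pos i)))"

definition pos_semidef :: "real^'n^'n \<Rightarrow> bool" where
  "pos_semidef A \<longleftrightarrow> transpose A = A \<and> (\<forall>v. 0 \<le> v \<bullet> (A *v v))"

definition sv_relaxation :: "real \<Rightarrow> real^'n^'n \<Rightarrow> real \<Rightarrow> real" where
  "sv_relaxation q X \<epsilon> =
     (1 + \<epsilon> powr q) *
       trace (transpose X ** matrix_inv (X ** transpose X + \<epsilon> *\<^sub>R mat 1) ** X)"

definition gradient :: "('a::real_inner \<Rightarrow> real) \<Rightarrow> 'a \<Rightarrow> 'a" where
  "gradient f x = (THE D. GDERIV f x :> D)"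

lemma gradient_eqI: "gradient f x = D" if "GDERIV f x :> D"
proof -
  have "E = D" if E: "GDERIV f x :> E" for E
  proof -
    have "(\<lambda>h. h \<bullet> E) = (\<lambda>h. h \<bullet> D)"
      using E \<open>GDERIV f x :> D\<close> unfolding gderiv_def by (rule has_derivative_unique)
    then have "\<forall>h. h \<bullet> E = h \<bullet> D"
      by (simp add: fun_eq_iff)
    then show "E = D"
      by (simp only: vector_eq_ldot)
  qed
  then show ?thesis
    unfolding gradient_def using that by (intro the_equality)
qed

lemma pos_bij: "bij_betw pos (UNIV :: 'a::{finite,linorder} set) {1..CARD('a)}"
proof -
  have mono: "pos i < pos j" if "i < j" for i j :: 'a
    unfolding pos_def by (rule psubset_card_mono) (use that in auto)
  have inj: "inj (pos :: 'a \<Rightarrow> nat)"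
    proof (rule injI)
    fix i j :: 'a
    assume "pos i = pos j"
    then show "i = j"
      using mono[of i j] mono[of j i] by (cases i j rule: linorder_cases) auto
  qed
  have "range (pos :: 'a \<Rightarrow> nat) \<subseteq> {1..CARD('a)}"
    unfolding pos_def by (auto simp: card_gt_0_iff Suc_le_eq intro!: card_mono)
  moreover have "card (range (pos :: 'a \<Rightarrow> nat)) = card {1..CARD('a)}"
    using card_image[OF inj] by simp
  ultimately have "range (pos :: 'a \<Rightarrow> nat) = {1..CARD('a)}"
    by (intro card_subset_eq) auto
  with inj show ?thesis
    by (simp add: bij_betw_def)
qed

lemma ex1_pos_upper_index:
  fixes i j :: "'n::{finite,linorder}"
  assumes "CARD('m::{finite,linorder}) = CARD('n) * (CARD('n) - 1) div 2" and "i < j"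
  shows "\<exists>!d :: 'm. pos d = upper_index CARD('n) (pos i) (pos j)"
proof -
  let ?n = "CARD('n)"
  have "pos i < pos j"
    unfolding pos_def by (rule psubset_card_mono) (use assms(2) in auto)
  moreover have "pos j \<le> ?n" "1 \<le> pos i"
    using bij_betw_apply[OF pos_bij, of j] bij_betw_apply[OF pos_bij, of i] by auto
  ultimately have ij: "1 \<le> pos i" "pos i < pos j" "pos j \<le> ?n" by auto
  have "upper_index ?n (pos i) (pos j) \<le> (\<Sum>k = 1..pos i - 1. ?n - k) + (?n - pos i)"
    unfolding upper_index_def using ij by auto
  also have "\<dots> = (\<Sum>k = 1..pos i. ?n - k)"
    using ij(1) by (cases "pos i") auto
  also have "\<dots> \<le> (\<Sum>k = 1..?n - 1. ?n - k)"
    using ij by (intro sum_mono2) auto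
  also have "\<dots> = (\<Sum>k = 1..?n - 1. k)"
    by (rule sum.reindex_bij_witness[of _ "\<lambda>k. ?n - k" "\<lambda>k. ?n - k"]) auto
  also have "\<dots> = CARD('m)"
    using Sum_Icc_nat[of 1 "?n - 1"] by (simp add: assms(1) mult.commute)
  finally have "upper_index ?n (pos i) (pos j) \<in> {1..CARD('m)}"
    using ij unfolding upper_index_def by auto
  then obtain d :: 'm where d: "pos d = upper_index ?n (pos i) (pos j)"
    unfolding bij_betw_imp_surj_on[OF pos_bij[where 'a='m], symmetric] by (elim imageE) simp
  show ?thesis
  proof (rule ex1I)
    show "pos d = upper_index ?n (pos i) (pos j)"
      by (rule d)
  next
    fix e :: 'm
    assume "pos e = upper_index ?n (pos i) (pos j)"
    then have "pos e = pos d"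
      by (simp only: d)
    then show "e = d"
      using bij_betw_imp_inj_on[OF pos_bij[where 'a='m]] by (simp only: inj_eq)
  qed
qed

end

theory Submission
  imports Defs
begin

text \<open>
  Write \<open>M = (X\<^sup>2 + \<epsilon>I)\<^sup>-\<^sup>1\<close> and \<open>c = 1 + \<epsilon>\<^sup>q\<close>. For symmetric \<open>X\<close> we have
  \<open>\<Phi>(X, \<epsilon>) = c(n - \<epsilon> tr M)\<close>, and the partial derivative in the direction of the entry
  \<open>(i, j)\<close> is \<open>4c\<epsilon> (MXM)\<^sub>i\<^sub>j\<close>. With \<open>t = 4c\<epsilon>\<alpha> \<le> \<epsilon>\<^sup>2\<close> the new matrix is therefore
  \<open>(X - t MXM) + t Diag(MXM)\<close>. The diagonal of the positive semidefinite matrix \<open>MXM\<close> is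
  nonnegative, and \<open>X - t MXM\<close> is positive semidefinite because conjugating it by
  \<open>N = X\<^sup>2 + \<epsilon>I\<close> gives \<open>X\<^sup>5 + 2\<epsilon>X\<^sup>3 + (\<epsilon>\<^sup>2 - t)X\<close>.
\<close>

section \<open>Matrix inverses\<close>

lemma matrix_inv_mult:
  fixes A :: "'a::semiring_1^'n^'n"
  assumes "invertible A"
  shows "A ** matrix_inv A = mat 1" "matrix_inv A ** A = mat 1"
  using someI_ex[OF assms[unfolded invertible_def]] by (auto simp: matrix_inv_def)

lemma matrix_inv_unique:
  fixes A :: "'a::semiring_1^'n^'n"
  assumes "A ** B = mat 1" "B ** A = mat 1"
  shows "matrix_inv A = B"
proof -
  have "invertible A"
    using assms by (auto simp: invertible_def)
  then have "B = B ** (A ** matrix_inv A)"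
    by (simp add: matrix_inv_mult)
  also have "\<dots> = matrix_inv A"
    using assms by (simp add: matrix_mul_assoc)
  finally show ?thesis by simp
qed

lemma transpose_matrix_inv:
  fixes A :: "'a::comm_ring_1^'n^'n"
  assumes "invertible A"
  shows "transpose (matrix_inv A) = matrix_inv (transpose A)"
  by (rule matrix_inv_unique[symmetric])
    (simp_all add: matrix_transpose_mul[symmetric] matrix_inv_mult[OF assms])

text \<open>Cramer's rule for the system whose solution is column \<open>l\<close> of the inverse.
  Entries become quotients of determinants, from which continuity of inversion can be read
  off.\<close>

lemma matrix_inv_component:
  fixes A :: "real^'n^'n"
  assumes "invertible A"
  shows "matrix_inv A $ k $ l
    = det (\<chi> i j. if j = k then axis l 1 $ i else A $ i $ j) / det A"
proof -
  have "A *v (matrix_inv A *v axis l 1) = axis l 1"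
    by (simp add: matrix_vector_mul_assoc matrix_inv_mult[OF assms])
  then have "matrix_inv A *v axis l 1
      = (\<chi> k. det (\<chi> i j. if j = k then axis l 1 $ i else A $ i $ j) / det A)"
    using cramer assms invertible_det_nz by blast
  moreover have "(matrix_inv A *v axis l 1) $ k = matrix_inv A $ k $ l"
    by (simp add: matrix_vector_mult_basis column_def)
  ultimately show ?thesis by simp
qed

section \<open>Continuity of matrix products, determinants and inverses\<close>

lemma continuous_on_matrix_matrix_mult [continuous_intros]:
  fixes F :: "'b::topological_space \<Rightarrow> real^'n^'m" and G :: "'b \<Rightarrow> real^'p^'n"
  assumes "continuous_on S F" "continuous_on S G"
  shows "continuous_on S (\<lambda>x. F x ** G x)"
  unfolding matrix_matrix_mult_def by (intro continuous_intros assms)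

lemma continuous_on_det [continuous_intros]:
  fixes F :: "'b::topological_space \<Rightarrow> real^'n^'n"
  assumes "continuous_on S F"
  shows "continuous_on S (\<lambda>x. det (F x))"
  unfolding det_def by (intro continuous_intros assms)

lemma continuous_on_matrix_inv:
  fixes F :: "'b::topological_space \<Rightarrow> real^'n^'n"
  assumes F: "continuous_on S F" and inv: "\<And>x. x \<in> S \<Longrightarrow> invertible (F x)"
  shows "continuous_on S (\<lambda>x. matrix_inv (F x))"
proof -
  \<comment> \<open>The condition \<open>j = k\<close> does not depend on \<open>x\<close>: each
    entry is either constant or an entry of \<open>F x\<close>.\<close>
  have "continuous_on S (\<lambda>x. if j = k then axis l 1 $ i else F x $ i $ j)" for i j k l
    using F by (cases "j = k") (auto intro!: continuous_intros)
  then have "continuous_on S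
      (\<lambda>x. \<chi> k l. det (\<chi> i j. if j = k then axis l 1 $ i else F x $ i $ j) / det (F x))"
    using inv by (intro continuous_intros F) (simp_all add: invertible_det_nz)
  then show ?thesis
    by (rule continuous_on_eq) (simp add: vec_eq_iff matrix_inv_component inv)
qed

section \<open>Regularized inverses and the gradient\<close>

abbreviation reg_gram :: "real \<Rightarrow> real^'n^'n \<Rightarrow> real^'n^'n" where
  "reg_gram \<epsilon> X \<equiv> X ** X + \<epsilon> *\<^sub>R mat 1"

abbreviation reg_inv :: "real \<Rightarrow> real^'n^'n \<Rightarrow> real^'n^'n" where
  "reg_inv \<epsilon> X \<equiv> matrix_inv (reg_gram \<epsilon> X)"

lemma symmetric_inner:
  fixes X :: "real^'n^'n"
  assumes "transpose X = X"
  shows "v \<bullet> (X *v w) = (X *v v) \<bullet> w"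
  by (metis assms dot_lmul_matrix transpose_matrix_vector)

text \<open>The quadratic form at \<open>v\<close> is |Xv|^2 + \<epsilon> |v|^2, so the kernel is
  trivial.\<close>

lemma invertible_reg_gram:
  fixes X :: "real^'n^'n"
  assumes X: "transpose X = X" and \<epsilon>: "\<epsilon> > 0"
  shows "invertible (reg_gram \<epsilon> X)"
proof -
  have "v = 0" if "reg_gram \<epsilon> X *v v = 0" for v
  proof -
    have "0 = v \<bullet> (reg_gram \<epsilon> X *v v)"
      using that by simp
    also have "\<dots> = (X *v v) \<bullet> (X *v v) + \<epsilon> * (v \<bullet> v)"
      by (simp add: algebra_simps matrix_vector_mul_assoc[symmetric] symmetric_inner[OF X]
          inner_add_right scaleR_matrix_vector_assoc[symmetric])
    finally have "\<epsilon> * (v \<bullet> v) \<le> 0"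
      using inner_ge_zero[of "X *v v"] by linarith
    with \<epsilon> show ?thesis
      using inner_ge_zero[of v] by (simp add: mult_le_0_iff order_antisym)
  qed
  then show ?thesis
    by (simp add: invertible_left_inverse matrix_left_invertible_ker)
qed

lemma matrix_add_rdistrib: "(A + B) ** C = A ** C + B ** C"
  by (simp add: matrix_matrix_mult_def vec_eq_iff algebra_simps sum.distrib)

lemma transpose_add: "transpose (A + B) = transpose A + transpose B"
  by (simp add: transpose_def vec_eq_iff)

lemma transpose_reg_inv:
  fixes X :: "real^'n^'n"
  assumes "transpose X = X" and "\<epsilon> > 0"
  shows "transpose (reg_inv \<epsilon> X) = reg_inv \<epsilon> X"
  using transpose_matrix_inv[OF invertible_reg_gram[OF assms]]
  by (simp add: transpose_add transpose_scalar matrix_transpose_mul assms)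

text \<open>\<open>X\<close> commutes with the polynomial X^2 + \<epsilon> I in itself; multiplying
  that identity by the inverse on both sides transfers it to the inverse.\<close>

lemma reg_inv_commute:
  fixes X :: "real^'n^'n"
  assumes "transpose X = X" and "\<epsilon> > 0"
  shows "X ** reg_inv \<epsilon> X = reg_inv \<epsilon> X ** X"
proof -
  let ?M = "reg_inv \<epsilon> X" and ?N = "reg_gram \<epsilon> X"
  note inv = matrix_inv_mult[OF invertible_reg_gram[OF assms]]
  have "?M ** (?N ** X) ** ?M = ?M ** (X ** ?N) ** ?M"
    by (simp add: matrix_add_ldistrib matrix_add_rdistrib matrix_scalar_ac
        scalar_matrix_assoc[symmetric] matrix_mul_assoc)
  then show ?thesis
    by (metis inv matrix_mul_assoc matrix_mul_lid matrix_mul_rid)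
qed

lemma matrix_diff_ldistrib:
  fixes A :: "'a::ring_1^'n^'m"
  shows "A ** (B - C) = A ** B - A ** C"
  by (simp add: matrix_matrix_mult_def vec_eq_iff algebra_simps sum_subtractf)

lemma matrix_diff_rdistrib:
  fixes A :: "'a::ring_1^'n^'m"
  shows "(A - B) ** C = A ** C - B ** C"
  by (simp add: matrix_matrix_mult_def vec_eq_iff algebra_simps sum_subtractf)

lemma trace_scaleR: "trace (r *\<^sub>R A) = r * trace (A :: real^'n^'n)"
  by (simp add: trace_def sum_distrib_left)

text \<open>Cyclicity of the trace produces M X^2, which equals I - \<epsilon> M.\<close>

lemma sv_relaxation_symmetric:
  fixes X :: "real^'n^'n"
  assumes X: "transpose X = X" and \<epsilon>: "\<epsilon> > 0"
  shows "sv_relaxation q X \<epsilon> = (1 + \<epsilon> powr q) * (CARD('n) - \<epsilon> * trace (reg_inv \<epsilon> X))"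
proof -
  let ?M = "reg_inv \<epsilon> X"
  have "trace (X ** ?M ** X) = trace (?M ** (X ** X))"
    by (metis matrix_mul_assoc trace_mul_sym)
  also have "?M ** (X ** X) = ?M ** reg_gram \<epsilon> X - \<epsilon> *\<^sub>R ?M"
    by (simp add: matrix_add_ldistrib matrix_scalar_ac scalar_matrix_assoc[symmetric])
  also have "trace \<dots> = CARD('n) - \<epsilon> * trace ?M"
    by (simp add: matrix_inv_mult[OF invertible_reg_gram[OF assms]] trace_sub trace_scaleR trace_I)
  finally show ?thesis
    by (simp add: sv_relaxation_def X)
qed

text \<open>Resolvent identity M - N = N (Z^2 - Y^2) M with Z^2 - Y^2 = Z (Z - Y) + (Z - Y) Y, then
  cyclicity of the trace. Being exact, with \<open>Z - Y\<close> as a factor, it reduces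
  differentiability to continuity of the other factor.\<close>

lemma sv_relaxation_diff:
  fixes Y Z :: "real^'n^'n"
  assumes Y: "transpose Y = Y" and Z: "transpose Z = Z" and \<epsilon>: "\<epsilon> > 0"
  shows "sv_relaxation q Z \<epsilon> - sv_relaxation q Y \<epsilon> = (1 + \<epsilon> powr q) * \<epsilon> *
    trace ((reg_inv \<epsilon> Y ** reg_inv \<epsilon> Z ** Z + Y ** reg_inv \<epsilon> Y ** reg_inv \<epsilon> Z) ** (Z - Y))"
proof -
  let ?M = "reg_inv \<epsilon> Y" and ?N = "reg_inv \<epsilon> Z"
  note iY = matrix_inv_mult[OF invertible_reg_gram[OF Y \<epsilon>]]
  note iZ = matrix_inv_mult[OF invertible_reg_gram[OF Z \<epsilon>]]
  have "?M - ?N = ?N ** reg_gram \<epsilon> Z ** ?M - ?N ** (reg_gram \<epsilon> Y ** ?M)"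
    by (simp add: iY iZ)
  also have "\<dots> = ?N ** (reg_gram \<epsilon> Z - reg_gram \<epsilon> Y) ** ?M"
    by (simp only: matrix_diff_ldistrib matrix_diff_rdistrib matrix_mul_assoc)
  also have "reg_gram \<epsilon> Z - reg_gram \<epsilon> Y = Z ** (Z - Y) + (Z - Y) ** Y"
    by (simp add: matrix_diff_ldistrib matrix_diff_rdistrib)
  finally have "trace ?M - trace ?N = trace (?N ** (Z ** (Z - Y) + (Z - Y) ** Y) ** ?M)"
    by (simp add: trace_sub[symmetric])
  also have "\<dots> = trace (?M ** ?N ** Z ** (Z - Y)) + trace (?M ** ?N ** (Z - Y) ** Y)"
    by (metis (no_types, lifting) matrix_add_ldistrib matrix_mul_assoc trace_add trace_mul_sym)
  also have "trace (?M ** ?N ** (Z - Y) ** Y) = trace (Y ** ?M ** ?N ** (Z - Y))"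
    by (metis matrix_mul_assoc trace_mul_sym)
  finally have "trace ?M - trace ?N = trace ((?M ** ?N ** Z + Y ** ?M ** ?N) ** (Z - Y))"
    by (simp add: matrix_add_rdistrib trace_add)
  then show ?thesis
    by (simp add: sv_relaxation_symmetric assms) (simp add: algebra_simps)
qed

text \<open>Caratheodory's form of differentiability: the linearization error is
  \<open>(y - x) \<bullet> (g y - g x)\<close>, which Cauchy-Schwarz bounds by
  \<open>norm (y - x)\<close> times a null function.\<close>

lemma GDERIV_caratheodory:
  fixes f :: "'a::real_inner \<Rightarrow> real"
  assumes diff: "\<And>z. f z - f x = (z - x) \<bullet> g z" and g: "isCont g x"
  shows "GDERIV f x :> g x"
proof -
  have "((\<lambda>y. norm (f y - f x - (y - x) \<bullet> g x) / norm (y - x)) \<longlongrightarrow> 0) (at x)"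
  proof (rule Lim_null_comparison)
    have "norm (f y - f x - (y - x) \<bullet> g x) \<le> norm (y - x) * norm (g y - g x)" for y
      using Cauchy_Schwarz_ineq2[of "y - x" "g y - g x"] by (simp add: diff inner_diff_right)
    then show "\<forall>\<^sub>F y in at x. norm (norm (f y - f x - (y - x) \<bullet> g x) / norm (y - x))
        \<le> norm (g y - g x)"
      by (auto simp: eventually_at_filter field_simps intro!: always_eventually)
    show "((\<lambda>y. norm (g y - g x)) \<longlongrightarrow> 0) (at x)"
      using g by (auto simp: isCont_def LIM_zero_iff intro: tendsto_norm_zero)
  qed
  then show ?thesis
    by (simp add: gderiv_def has_derivative_iff_norm bounded_linear_inner_left)
qed

section \<open>The enumeration of the strictly upper triangular entries\<close>

text \<open>Row \<open>i\<close> ends no later than position (n - 1) + ... + (n - i), and every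
  later row starts strictly beyond it.\<close>

lemma upper_index_less:
  assumes "1 \<le> i" "i < j" "j \<le> n" "i < i'" "i' < j'"
  shows "upper_index n i j < upper_index n i' j'"
proof -
  have "upper_index n i j \<le> (\<Sum>k = 1..i - 1. n - k) + (n - i)"
    unfolding upper_index_def using assms by auto
  also have "\<dots> = (\<Sum>k = 1..i. n - k)"
    using assms(1) by (cases i) auto
  also have "\<dots> \<le> (\<Sum>k = 1..i' - 1. n - k)"
    using assms by (intro sum_mono2) auto
  also have "\<dots> < upper_index n i' j'"
    using assms by (simp add: upper_index_def)
  finally show ?thesis .
qed

lemma upper_index_inject:
  assumes "1 \<le> i" "i < j" "j \<le> n" "1 \<le> i'" "i' < j'" "j' \<le> n"
    and eq: "upper_index n i j = upper_index n i' j'"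
  shows "i = i' \<and> j = j'"
proof -
  have "i = i'"
    using upper_index_less[of i j n i' j'] upper_index_less[of i' j' n i j] assms
    by (metis less_irrefl linorder_neqE_nat)
  then show ?thesis
    using assms by (simp add: upper_index_def)
qed

lemma pos_less: "i < j \<Longrightarrow> pos i < pos j" for i j :: "'a::{finite,linorder}"
  unfolding pos_def by (rule psubset_card_mono) auto

lemma pos_inject: "pos i = pos j \<longleftrightarrow> i = j" for i j :: "'a::{finite,linorder}"
  by (rule inj_eq[OF bij_betw_imp_inj_on[OF pos_bij]])

text \<open>\<open>min\<close> and \<open>max\<close> let one formula serve both triangles. The
  value at \<open>i = j\<close> is meaningless, so uses are guarded by
  \<open>i \<noteq> j\<close>.\<close>

definition entry_index :: "'n::{finite,linorder} \<Rightarrow> 'n \<Rightarrow> 'm::{finite,linorder}" where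
  "entry_index i j = (THE d. pos d = upper_index CARD('n) (pos (min i j)) (pos (max i j)))"

lemma entry_index_commute: "entry_index i j = entry_index j i"
  by (simp add: entry_index_def min.commute max.commute)

lemma unit_diag_matrix_component:
  "unit_diag_matrix y $ i $ j = (if i = j then 1 else y $ entry_index i j)"
  by (auto simp: unit_diag_matrix_def entry_index_def min_def max_def)

lemma transpose_unit_diag_matrix: "transpose (unit_diag_matrix y) = unit_diag_matrix y"
  by (auto simp: vec_eq_iff transpose_def unit_diag_matrix_component entry_index_commute)

lemma pos_entry_index:
  fixes i j :: "'n::{finite,linorder}"
  assumes "CARD('m) = CARD('n) * (CARD('n) - 1) div 2" and "i \<noteq> j"
  shows "pos (entry_index i j :: 'm::{finite,linorder})
    = upper_index CARD('n) (pos (min i j)) (pos (max i j))"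
  unfolding entry_index_def
  by (rule theI'[OF ex1_pos_upper_index]) (use assms in \<open>auto simp: min_def max_def\<close>)

text \<open>Each coordinate of the vector fills exactly two mirror positions of the matrix; this
  decides which terms survive in a partial derivative.\<close>

lemma entry_index_eq_iff:
  fixes i j k l :: "'n::{finite,linorder}"
  assumes "CARD('m) = CARD('n) * (CARD('n) - 1) div 2" and "i \<noteq> j" and "k \<noteq> l"
  shows "(entry_index i j :: 'm::{finite,linorder}) = entry_index k l
    \<longleftrightarrow> i = k \<and> j = l \<or> i = l \<and> j = k"
proof
  assume "(entry_index i j :: 'm) = entry_index k l"
  then have eq: "upper_index CARD('n) (pos (min i j)) (pos (max i j))
      = upper_index CARD('n) (pos (min k l)) (pos (max k l))"
    by (metis pos_entry_index assms)
  have rng: "1 \<le> pos a" "pos a \<le> CARD('n)" for a :: 'n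
    using bij_betw_apply[OF pos_bij, of a] by auto
  have less: "pos (min a b) < pos (max a b)" if "a \<noteq> b" for a b :: 'n
    using that by (intro pos_less) (auto simp: min_def max_def)
  have "min i j = min k l \<and> max i j = max k l"
    using upper_index_inject[OF _ _ _ _ _ _ eq] less rng assms by (simp add: pos_inject)
  then show "i = k \<and> j = l \<or> i = l \<and> j = k"
    by (auto simp: min_def max_def split: if_splits)
qed (auto simp: entry_index_commute)

section \<open>The gradient step\<close>

text \<open>The 4 is 2 times 2: the two summands of the difference factor coincide at
  \<open>x\<close>, and each coordinate occupies two mirror positions.\<close>

lemma gradient_sv_relaxation:
  fixes x :: "real^'m::{finite,linorder}" and X :: "real^'n::{finite,linorder}^'n::{finite,linorder}"
  assumes card: "CARD('m) = CARD('n) * (CARD('n) - 1) div 2" and \<epsilon>: "\<epsilon> > 0"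
    and X: "X = unit_diag_matrix x" and "i \<noteq> j"
  shows "gradient (\<lambda>y. sv_relaxation q (unit_diag_matrix y :: real^'n::{finite,linorder}^'n::{finite,linorder}) \<epsilon>) x $ entry_index i j
    = 4 * (1 + \<epsilon> powr q) * \<epsilon> * (reg_inv \<epsilon> X ** X ** reg_inv \<epsilon> X) $ i $ j"
proof -
  let ?U = "unit_diag_matrix :: real^'m::{finite,linorder} \<Rightarrow> real^'n::{finite,linorder}^'n::{finite,linorder}"
  let ?f = "\<lambda>y. sv_relaxation q (?U y) \<epsilon>"
  let ?M = "reg_inv \<epsilon> X"
  define C where "C = (1 + \<epsilon> powr q) * \<epsilon>"
  define K where "K z = ?M ** reg_inv \<epsilon> (?U z) ** ?U z + X ** ?M ** reg_inv \<epsilon> (?U z)" for z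
  \<comment> \<open>The Caratheodory factor: coordinate \<open>d\<close> collects the entries of
    \<open>K z\<close> at the off-diagonal positions filled by \<open>d\<close>.\<close>
  define g :: "real^'m::{finite,linorder} \<Rightarrow> real^'m::{finite,linorder}" where
    "g z = (\<chi> d. C * (\<Sum>k\<in>UNIV. \<Sum>l\<in>UNIV.
       (if k \<noteq> l \<and> d = entry_index k l then K z $ k $ l else 0)))" for z
  have symX: "transpose X = X"
    by (simp add: X transpose_unit_diag_matrix)
  have diff: "?f z - ?f x = (z - x) \<bullet> g z" for z
  proof -
    let ?h = "\<lambda>d k l. (z - x) $ d * (if k \<noteq> l \<and> d = entry_index k l then K z $ k $ l else 0)"
    have "?f z - ?f x = C * trace (K z ** (?U z - X))"
      using sv_relaxation_diff[OF symX transpose_unit_diag_matrix \<epsilon>, of q z]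
      by (simp add: C_def K_def X)
    also have "trace (K z ** (?U z - X)) = (\<Sum>k\<in>UNIV. \<Sum>l\<in>UNIV. \<Sum>d\<in>UNIV. ?h d k l)"
    proof -
      \<comment> \<open>The unit diagonals cancel in \<open>?U z - X\<close>; off the diagonal only
        \<open>d = entry_index k l\<close> contributes.\<close>
      have "K z $ k $ l * (?U z - X) $ l $ k = (\<Sum>d\<in>UNIV. ?h d k l)" for k l
        by (cases "k = l") (simp_all add: X unit_diag_matrix_component entry_index_commute[of l k]
            if_distrib[of "(*) _"] mult.commute cong: if_cong)
      then show ?thesis
        by (simp add: trace_def matrix_matrix_mult_def del: vector_minus_component)
    qed
    also have "\<dots> = (\<Sum>k\<in>UNIV. \<Sum>d\<in>UNIV. \<Sum>l\<in>UNIV. ?h d k l)"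
      by (intro sum.cong refl sum.swap)
    also have "\<dots> = (\<Sum>d\<in>UNIV. \<Sum>k\<in>UNIV. \<Sum>l\<in>UNIV. ?h d k l)"
      by (rule sum.swap)
    also have "C * \<dots> = (z - x) \<bullet> g z"
      by (simp add: inner_vec_def g_def sum_distrib_left mult.left_commute del: vector_minus_component)
    finally show ?thesis .
  qed
  have U: "continuous_on UNIV ?U"
  proof -
    have "continuous_on UNIV (\<lambda>z. ?U z $ k $ l)" for k l
      by (cases "k = l") (auto simp: unit_diag_matrix_component intro!: continuous_intros)
    then have "continuous_on UNIV (\<lambda>z. \<chi> k l. ?U z $ k $ l)"
      by (intro continuous_on_vec_lambda)
    then show ?thesis by simp
  qed
  have "continuous_on UNIV K"
    unfolding K_def
    by (intro continuous_intros continuous_on_matrix_inv U invertible_reg_gram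
        transpose_unit_diag_matrix \<epsilon>)
  then have "continuous_on UNIV (\<lambda>z. if b then K z $ k $ l else 0)" for b k l
    by (cases b) (auto intro!: continuous_intros)
  then have "continuous_on UNIV g"
    unfolding g_def by (intro continuous_intros)
  then have "isCont g x"
    by (simp add: continuous_on_eq_continuous_at)
  then have grad: "gradient ?f x = g x"
    by (intro gradient_eqI GDERIV_caratheodory diff)
  \<comment> \<open>At \<open>z = x\<close> both inverses are \<open>?M\<close>, and commuting
    \<open>X\<close> past \<open>?M\<close> turns each summand into
    \<open>?M ** X ** ?M\<close>.\<close>
  have "K x = ?M ** (?M ** X) + (X ** ?M) ** ?M"
    by (simp add: K_def X matrix_mul_assoc)
  also have "X ** ?M = ?M ** X"
    by (rule reg_inv_commute[OF symX \<epsilon>])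
  also have "?M ** (?M ** X) = ?M ** X ** ?M"
    by (simp only: reg_inv_commute[OF symX \<epsilon>, symmetric] matrix_mul_assoc)
  also have "?M ** X ** ?M + ?M ** X ** ?M = 2 *\<^sub>R (?M ** X ** ?M)"
    by (simp only: scaleR_2)
  finally have K: "K x = 2 *\<^sub>R (?M ** X ** ?M)" .
  have symK: "transpose (K x) = K x"
    by (simp add: K transpose_scalar matrix_transpose_mul transpose_reg_inv[OF symX \<epsilon>] symX
        matrix_mul_assoc)
  have "g x $ entry_index i j = C * (\<Sum>k\<in>UNIV. \<Sum>l\<in>UNIV.
      (if k \<noteq> l \<and> (i = k \<and> j = l \<or> i = l \<and> j = k) then K x $ k $ l else 0))"
    by (auto simp: g_def entry_index_eq_iff[OF card \<open>i \<noteq> j\<close>] intro!: sum.cong arg_cong[of _ _ "(*) C"])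
  \<comment> \<open>Since \<open>i \<noteq> j\<close>, the two positions are distinct and the
    disjunction splits into a sum without double counting.\<close>
  also have "\<dots> = C * (\<Sum>k\<in>UNIV. \<Sum>l\<in>UNIV.
      (if l = j then if k = i then K x $ i $ j else 0 else 0) +
      (if l = i then if k = j then K x $ j $ i else 0 else 0))"
    using \<open>i \<noteq> j\<close> by (auto intro!: sum.cong arg_cong[of _ _ "(*) C"])
  also have "\<dots> = C * (K x $ i $ j + K x $ j $ i)"
    by (simp add: sum.distrib)
  also have "K x $ j $ i = K x $ i $ j"
    by (metis symK transpose_def vec_lambda_beta)
  finally show ?thesis
    by (simp add: grad K C_def)
qed

text \<open>The diagonal of \<open>Q\<close> is added back because the gradient step moves only
  off-diagonal entries.\<close>

lemma pos_semidef_step: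
  fixes X :: "real^'n^'n"
  assumes psd: "pos_semidef X" and \<epsilon>: "\<epsilon> > 0" and t: "0 \<le> t" "t \<le> \<epsilon>\<^sup>2"
  defines "Q \<equiv> reg_inv \<epsilon> X ** X ** reg_inv \<epsilon> X"
  shows "pos_semidef (X - t *\<^sub>R Q + t *\<^sub>R (\<chi> i j. if i = j then Q $ i $ j else 0))"
proof -
  let ?M = "reg_inv \<epsilon> X" and ?N = "reg_gram \<epsilon> X"
  have symX: "transpose X = X" and nn: "\<And>v. 0 \<le> v \<bullet> (X *v v)"
    using psd by (auto simp: pos_semidef_def)
  note symM = transpose_reg_inv[OF symX \<epsilon>]
  have Q: "v \<bullet> (Q *v v) = (?M *v v) \<bullet> (X *v (?M *v v))" for v
    by (simp add: Q_def matrix_vector_mul_assoc[symmetric] symmetric_inner[OF symM])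
  have symQ: "transpose Q = Q"
    by (simp add: Q_def matrix_transpose_mul symM symX matrix_mul_assoc)
  then have Qij: "Q $ i $ j = Q $ j $ i" for i j
    by (metis transpose_def vec_lambda_beta)
  \<comment> \<open>A diagonal entry is the quadratic form at a basis vector, and the form of
    \<open>Q\<close> at \<open>v\<close> is that of \<open>X\<close> at
    \<open>?M *v v\<close>.\<close>
  have diag: "0 \<le> Q $ i $ i" for i
    using nn[of "?M *v axis i 1"] Q[of "axis i 1"]
    by (simp add: matrix_vector_mult_basis inner_axis' column_def)
  have main: "t * (v \<bullet> (Q *v v)) \<le> v \<bullet> (X *v v)" for v
  proof -
    define w where "w = ?M *v v"
    have "v = ?N *v w"
      by (simp add: w_def matrix_vector_mul_assoc matrix_inv_mult[OF invertible_reg_gram[OF symX \<epsilon>]])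
    then have v: "v = X *v (X *v w) + \<epsilon> *\<^sub>R w"
      by (simp add: matrix_vector_mult_add_rdistrib scaleR_matrix_vector_assoc[symmetric]
          matrix_vector_mul_assoc[symmetric])
    let ?a = "X *v w" and ?b = "X *v (X *v w)"
    \<comment> \<open>The terms in X^5, X^3 and X are forms of \<open>X\<close> at X^2 w, X w and w.
      All are nonnegative, and the last alone dominates the \<open>t\<close> term because t \<le>
      \<epsilon>^2.\<close>
    have "v \<bullet> (X *v v) = ?b \<bullet> (X *v ?b) + 2 * \<epsilon> * (?a \<bullet> (X *v ?a)) + \<epsilon>\<^sup>2 * (w \<bullet> (X *v w))"
      unfolding v
      by (simp add: matrix_vector_right_distrib matrix_vector_mult_scaleR inner_add_left
          inner_add_right symmetric_inner[OF symX] power2_eq_square algebra_simps)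
    moreover have "0 \<le> 2 * \<epsilon> * (?a \<bullet> (X *v ?a))"
      using nn \<epsilon> by simp
    moreover have "t * (w \<bullet> (X *v w)) \<le> \<epsilon>\<^sup>2 * (w \<bullet> (X *v w))"
      using t nn by (intro mult_right_mono)
    ultimately show ?thesis
      using nn[of ?b] by (simp add: Q w_def[symmetric])
  qed
  let ?D = "\<chi> i j. if i = j then Q $ i $ j else 0"
  have "transpose (X - t *\<^sub>R Q + t *\<^sub>R ?D) = X - t *\<^sub>R Q + t *\<^sub>R ?D"
    using symX Qij by (auto simp: transpose_def vec_eq_iff)
  moreover have "0 \<le> v \<bullet> ((X - t *\<^sub>R Q + t *\<^sub>R ?D) *v v)" for v
  proof -
    have "(?D *v v) $ i = Q $ i $ i * v $ i" for i
      by (simp add: matrix_vector_mult_def if_distrib[of "\<lambda>t. t * _"] cong: if_cong)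
    then have "v \<bullet> (?D *v v) = (\<Sum>i\<in>UNIV. Q $ i $ i * (v $ i)\<^sup>2)"
      by (simp add: inner_vec_def power2_eq_square mult_ac)
    also have "\<dots> \<ge> 0"
      using diag by (intro sum_nonneg) simp
    finally have "0 \<le> t * (v \<bullet> (?D *v v))"
      using t by simp
    with main[of v] show ?thesis
      by (simp add: matrix_vector_mult_add_rdistrib matrix_vector_mult_diff_rdistrib
          scaleR_matrix_vector_assoc[symmetric] inner_add_right inner_diff_right)
  qed
  ultimately show ?thesis
    by (simp add: pos_semidef_def)
qed

theorem theorem1:
  fixes \<epsilon> q \<alpha> :: real
    and x :: "real^'m::{finite,linorder}"
    and X :: "real^'m::{finite,linorder} \<Rightarrow> real^'n::{finite,linorder}^'n::{finite,linorder}"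
    and f :: "real^'m::{finite,linorder} \<Rightarrow> real"
  assumes "CARD('n) \<ge> 2"
    and "CARD('m) = CARD('n) * (CARD('n) - 1) div 2"
    and "\<epsilon> > 0"
    and "q \<in> \<rat>" and "0 \<le> q" and "q \<le> 1"
    and "X = unit_diag_matrix"
    and "f = (\<lambda>y. sv_relaxation q (X y) \<epsilon>)"
    and "pos_semidef (X x)"
    and "0 \<le> \<alpha>" and "\<alpha> \<le> \<epsilon> / (4 * (1 + \<epsilon> powr q))"
  shows "pos_semidef (X (x - \<alpha> *\<^sub>R gradient f x))"
proof -
  define t where "t = 4 * (1 + \<epsilon> powr q) * \<epsilon> * \<alpha>"
  define Q where "Q = reg_inv \<epsilon> (X x) ** X x ** reg_inv \<epsilon> (X x)"
  have c: "1 + \<epsilon> powr q > 0"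
    by (simp add: add_pos_nonneg)
  \<comment> \<open>Clearing the denominator of the step bound and multiplying by \<epsilon> gives
    exactly t \<le> \<epsilon>^2.\<close>
  have "\<alpha> * (4 * (1 + \<epsilon> powr q)) \<le> \<epsilon>"
    using assms(11) c by (simp add: field_simps)
  then have "\<epsilon> * (\<alpha> * (4 * (1 + \<epsilon> powr q))) \<le> \<epsilon> * \<epsilon>"
    using \<open>\<epsilon> > 0\<close> by (intro mult_left_mono) auto
  then have t: "0 \<le> t" "t \<le> \<epsilon>\<^sup>2"
    using assms c by (auto simp: t_def power2_eq_square mult_ac)
  \<comment> \<open>Off the diagonal the step subtracts \<open>t *\<^sub>R Q\<close>; on it the
    entries stay 1, so the two \<open>Q\<close> terms must cancel there.\<close>
  have "X (x - \<alpha> *\<^sub>R gradient f x)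
      = X x - t *\<^sub>R Q + t *\<^sub>R (\<chi> i j. if i = j then Q $ i $ j else 0)"
    using gradient_sv_relaxation[OF assms(2,3) refl, where x = x and q = q]
    by (auto simp: vec_eq_iff assms(7,8) unit_diag_matrix_component Q_def t_def)
  then show ?thesis
    using pos_semidef_step[OF assms(9) assms(3) t] by (simp only: Q_def)
qed

end
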